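(* For every nonempty signed graph $\Sigma$, $$\overline{\vartheta}_{\mathrm b}(\Sigma)=\gamma_{\mathrm{BTH}(\Sigma)}(\mathbf 1),$$ where $\mathbf 1$ is the all-ones vector and $\gamma_{C}(z)=\inf\{\lambda>0:z\in\lambda C\}$ is the gauge of a convex corner $C$.
   Context: Signed graphs. A signed graph is a pair $\Sigma=(G,\sigma)$ with $G$ a finite graph and $\sigma:E(G)\to\{+1,-1\}$. Positive loops are allowed, negative loops are excluded; between two distinct vertices there may be both a positive and a negative edge (a digon); repeated edges of the same sign are immaterial. Convention: every signed graph is replaced by its completion having a positive loop at every vertex. Signed homomorphism. A signed homomorphism $\Sigma\to\Pi$ consists of a switching function $\tau:V(\Sigma)\to\{\pm1\}$ and a vertex map $f:V(\Sigma)\to V(\Pi)$ such that for every edge $e=uv$ of $\Sigma$ the signed graph $\Pi$ contains an edge between $f(u)$ and $f(v)$ of sign $\tau(u)\sigma(e)\tau(v)$. Signed sphere. Let $\mathcal H=\mathcal H_+\oplus\mathcal H_-$ be a finite-dimensional real inner-product space (orthogonal direct sum) and $R(a,b)=(a,-b)$. For $t\ge1$ put $\gamma_t=\frac1{1-2t}$. The (infinite) signed graph $\mathcal S_t(\mathcal H,R)$ has vertex set $\{x\in\mathcal H:\|x\|=1,\ \langle x,Rx\rangle=\gamma_t\}$; $x,y$ are joined by a negative edge iff $\langle x,y\rangle=\gamma_t$, and by a positive edge iff $\langle x,Ry\rangle=\gamma_t$ (both may hold; $x=y$ allowed). Balanced theta parameter. For nonempty $\Sigma$ (with positive loops adjoined),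 $\overline{\vartheta}_{\mathrm b}(\Sigma)=\inf\{t\ge1:\text{there is a signed homomorphism }\Sigma\to\mathcal S_t(\mathcal H,R)\text{ for some finite-dimensional }\mathcal H=\mathcal H_+\oplus\mathcal H_-\}$. Conflict graph. $C(\Sigma)$ is the ordinary simple graph on $V(\Sigma)\times\{\pm1\}$ with $(u,s)\sim(v,r)$ iff there is an edge $e=uv$ of $\Sigma$ (possibly a loop, $u=v$) with $r=-\sigma(e)s$. In particular $(v,+)\sim(v,-)$ for all $v$. Theta body. For a finite simple graph $H$, $\mathrm{TH}(H)=\{x:\exists\, X\text{ symmetric with }\begin{pmatrix} 1 & x^{\mathsf T} \\ x & X \end{pmatrix}\succeq0,\ \operatorname{diag}X=x,\ X_{uv}=0\ (uv\in E(H))\}$. Signed theta body. Let $p:\mathbb R^{V(\Sigma)\times\{\pm1\}}\to\mathbb R^{V(\Sigma)}$, $p(y)_v=y_{(v,+)}+y_{(v,-)}$. Then $\mathrm{BTH}(\Sigma)=p(\mathrm{TH}(C(\Sigma)))$; it is a convex corner (compact convex subset of $\mathbb R_+^{V(\Sigma)}$ with nonempty interior, closed under passing to $0\le y\le x$). *)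

theory Defs
  imports "HOL-Analysis.Analysis"
begin

section \<open>Signs and signed graphs\<close>

text \<open>The group of order two, written multiplicatively; an own type so that
  pairs of a vertex and a sign can index vectors.\<close>

datatype sign = Plus | Minus

instantiation sign :: "{finite, comm_monoid_mult, uminus}"
begin

definition one_sign :: sign where "1 = Plus"
definition times_sign :: "sign \<Rightarrow> sign \<Rightarrow> sign" where
  "s * r = (if s = r then Plus else Minus)"
definition uminus_sign :: "sign \<Rightarrow> sign" where
  "- s = (case s of Plus \<Rightarrow> Minus | Minus \<Rightarrow> Plus)"

instance
proof
  have "(UNIV :: sign set) = {Plus, Minus}"
    using sign.exhaust by auto
  then show "finite (UNIV :: sign set)"
    by (metis finite.intros)
  fix a b c :: sign
  show "a * b * c = a * (b * c)"
    by (cases a; cases b; cases c) (simp_all add: times_sign_def)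
  show "a * b = b * a"
    by (simp add: times_sign_def)
  show "1 * a = a"
    by (cases a) (simp_all add: times_sign_def one_sign_def)
qed

end

text \<open>Since repeated edges of the same sign are immaterial, a signed graph is given by the
  information, for each pair of vertices and each sign, whether an edge of that sign joins them.
  The vertex set is explicit because the signed sphere below is an infinite signed graph carried
  by a subset of its ambient space.\<close>

record 'v sgraph =
  verts :: "'v set"
  edge :: "'v \<Rightarrow> 'v \<Rightarrow> sign \<Rightarrow> bool"

definition signed_graph :: "'v sgraph \<Rightarrow> bool" where
  "signed_graph \<Sigma> \<longleftrightarrow>
     (\<forall>u v s. edge \<Sigma> u v s \<longrightarrow> u \<in> verts \<Sigma> \<and> v \<in> verts \<Sigma> \<and> edge \<Sigma> v u s) \<and>
     (\<forall>v. \<not> edge \<Sigma> v v Minus)"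

definition completion :: "'v sgraph \<Rightarrow> 'v sgraph" where
  "completion \<Sigma> =
     \<lparr>verts = verts \<Sigma>,
      edge = (\<lambda>u v s. edge \<Sigma> u v s \<or> (u = v \<and> v \<in> verts \<Sigma> \<and> s = Plus))\<rparr>"

definition signed_hom :: "('v \<Rightarrow> sign) \<Rightarrow> ('v \<Rightarrow> 'w) \<Rightarrow> 'v sgraph \<Rightarrow> 'w sgraph \<Rightarrow> bool" where
  "signed_hom \<tau> f \<Sigma> \<Gamma> \<longleftrightarrow>
     f ` verts \<Sigma> \<subseteq> verts \<Gamma> \<and>
     (\<forall>u v s. edge \<Sigma> u v s \<longrightarrow> edge \<Gamma> (f u) (f v) (\<tau> u * s * \<tau> v))"


section \<open>Signed spheres\<close>

text \<open>The space \<open>H = H\<^sub>+ \<oplus> H\<^sub>-\<close> is the set of pairs \<open>Hp \<times> Hm\<close>; the inner product on the product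
  type is the sum of those of the components, so the sum is orthogonal.\<close>

definition gamma_t :: "real \<Rightarrow> real" where
  "gamma_t t = 1 / (1 - 2 * t)"

definition reflection :: "'a::real_inner \<times> 'b::real_inner \<Rightarrow> 'a \<times> 'b" where
  "reflection x = (fst x, - snd x)"

definition signed_sphere ::
    "real \<Rightarrow> 'a::real_inner set \<Rightarrow> 'b::real_inner set \<Rightarrow> ('a \<times> 'b) sgraph" where
  "signed_sphere t Hp Hm =
     (let V = {x \<in> Hp \<times> Hm. norm x = 1 \<and> x \<bullet> reflection x = gamma_t t}
      in \<lparr>verts = V,
          edge = (\<lambda>x y s. x \<in> V \<and> y \<in> V \<and>
             (case s of Plus \<Rightarrow> x \<bullet> reflection y = gamma_t t
                      | Minus \<Rightarrow> x \<bullet> y = gamma_t t))\<rparr>)"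

definition finite_dimensional :: "'a::real_vector set \<Rightarrow> bool" where
  "finite_dimensional H \<longleftrightarrow> (\<exists>B. finite B \<and> H = span B)"

text \<open>Quantifying over all finite-dimensional inner product spaces is done by quantifying over
  the finite-dimensional subspaces of one infinite-dimensional inner product space, the finitely
  supported real sequences. Lemma \<open>signed_hom_universal\<close> below shows that no space is missed.\<close>

typedef fseq = "{f :: nat \<Rightarrow> real. finite {i. f i \<noteq> 0}}"
  morphisms coord Abs_fseq
  by (rule exI[of _ "\<lambda>_. 0"]) simp

setup_lifting type_definition_fseq

instantiation fseq :: real_vector
begin

lift_definition zero_fseq :: fseq is "\<lambda>_. 0" by simp
lift_definition plus_fseq :: "fseq \<Rightarrow> fseq \<Rightarrow> fseq" is "\<lambda>f g i. f i + g i"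
  subgoal for f g
    by (rule finite_subset[of _ "{i. f i \<noteq> 0} \<union> {i. g i \<noteq> 0}"]) auto
  done
lift_definition minus_fseq :: "fseq \<Rightarrow> fseq \<Rightarrow> fseq" is "\<lambda>f g i. f i - g i"
  subgoal for f g
    by (rule finite_subset[of _ "{i. f i \<noteq> 0} \<union> {i. g i \<noteq> 0}"]) auto
  done
lift_definition uminus_fseq :: "fseq \<Rightarrow> fseq" is "\<lambda>f i. - f i" by simp
lift_definition scaleR_fseq :: "real \<Rightarrow> fseq \<Rightarrow> fseq" is "\<lambda>c f i. c * f i"
  subgoal for c f
    by (rule finite_subset[of _ "{i. f i \<noteq> 0}"]) auto
  done

instance
  by standard (transfer; simp add: algebra_simps fun_eq_iff)+

end

instantiation fseq :: real_inner
begin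

lift_definition inner_fseq :: "fseq \<Rightarrow> fseq \<Rightarrow> real" is
  "\<lambda>f g. \<Sum>i | f i \<noteq> 0. f i * g i" .
definition norm_fseq :: "fseq \<Rightarrow> real" where "norm_fseq x = sqrt (x \<bullet> x)"
definition sgn_fseq :: "fseq \<Rightarrow> fseq" where "sgn_fseq x = x /\<^sub>R norm x"
definition dist_fseq :: "fseq \<Rightarrow> fseq \<Rightarrow> real" where "dist_fseq x y = norm (x - y)"
definition uniformity_fseq :: "(fseq \<times> fseq) filter" where
  "uniformity_fseq = (INF e\<in>{0 <..}. principal {(x, y). dist x y < e})"
definition open_fseq :: "fseq set \<Rightarrow> bool" where
  "open_fseq U \<longleftrightarrow> (\<forall>x\<in>U. eventually (\<lambda>(x', y). x' = x \<longrightarrow> y \<in> U) uniformity)"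

lemma inner_fseq_superset:
  assumes "finite A" "{i. coord x i \<noteq> 0} \<subseteq> A"
  shows "x \<bullet> y = (\<Sum>i\<in>A. coord x i * coord y i)"
  unfolding inner_fseq.rep_eq
  by (rule sum.mono_neutral_left) (use assms in auto)

instance
proof
  fix x y z :: fseq and c :: real
  define A where "A = {i. coord x i \<noteq> 0} \<union> {i. coord y i \<noteq> 0} \<union> {i. coord z i \<noteq> 0}"
  have fin: "finite A"
    using coord[of x] coord[of y] coord[of z] by (simp add: A_def)
  note * = inner_fseq_superset[OF fin]
  have xy: "x \<bullet> y = (\<Sum>i\<in>A. coord x i * coord y i)"
    by (rule *) (auto simp: A_def)
  show "x \<bullet> y = y \<bullet> x"
    unfolding xy by (subst *) (auto simp: A_def mult.commute)
  show "(x + y) \<bullet> z = x \<bullet> z + y \<bullet> z"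
    by (subst (1 2 3) *) (auto simp: A_def plus_fseq.rep_eq sum.distrib algebra_simps)
  show "(c *\<^sub>R x) \<bullet> y = c * (x \<bullet> y)"
    unfolding xy
    by (subst *) (auto simp: A_def scaleR_fseq.rep_eq sum_distrib_left algebra_simps)
  show "0 \<le> x \<bullet> x"
    unfolding inner_fseq.rep_eq by (rule sum_nonneg) simp
  have "finite {i. coord x i \<noteq> 0}"
    using coord[of x] by simp
  then have "x \<bullet> x = 0 \<longleftrightarrow> (\<forall>i. coord x i = 0)"
    unfolding inner_fseq.rep_eq by (subst sum_nonneg_eq_0_iff) auto
  then show "x \<bullet> x = 0 \<longleftrightarrow> x = 0"
    by (simp add: coord_inject[symmetric] zero_fseq.rep_eq fun_eq_iff)
qed (simp_all add: norm_fseq_def sgn_fseq_def dist_fseq_def uniformity_fseq_def open_fseq_def)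

end

lift_definition unit_fseq :: "nat \<Rightarrow> fseq" is "\<lambda>k i. if i = k then 1 else 0"
  by simp

lemma inner_unit_fseq: "unit_fseq k \<bullet> unit_fseq l = (if k = l then 1 else 0)"
  by (subst inner_fseq_superset[where A = "{k}"]) (auto simp: unit_fseq.rep_eq)

lemma norm_unit_fseq: "norm (unit_fseq k) = 1"
  by (simp add: norm_eq_sqrt_inner inner_unit_fseq)

lemma finite_dimensional_embed:
  fixes H :: "'a::real_inner set"
  assumes "finite_dimensional H"
  obtains \<phi> :: "'a \<Rightarrow> fseq" where "linear \<phi>" "finite_dimensional (\<phi> ` H)"
    "\<And>x y. x \<in> H \<Longrightarrow> y \<in> H \<Longrightarrow> \<phi> x \<bullet> \<phi> y = x \<bullet> y"
proof -
  obtain B where "finite B" "H = span B"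
    using assms by (auto simp: finite_dimensional_def)
  then obtain C where C: "finite C" "H = span C" "pairwise orthogonal C"
    using basis_orthogonal by metis
  obtain h :: "'a \<Rightarrow> nat" where h: "inj_on h C"
    using finite_imp_inj_to_nat_seg[OF C(1)] by blast
  define \<phi> where "\<phi> x = (\<Sum>c\<in>C. (x \<bullet> c / norm c) *\<^sub>R unit_fseq (h c))" for x
  have lin: "linear \<phi>"
    by (rule linearI)
      (simp_all add: \<phi>_def inner_add_left add_divide_distrib scaleR_add_left sum.distrib
        scaleR_sum_right)
  have \<phi>C: "\<phi> c = norm c *\<^sub>R unit_fseq (h c)" if "c \<in> C" for c
  proof -
    have "\<phi> c = (\<Sum>d\<in>C. if d = c then norm c *\<^sub>R unit_fseq (h c) else 0)"
      unfolding \<phi>_def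
    proof (rule sum.cong)
      fix d assume "d \<in> C"
      show "(c \<bullet> d / norm d) *\<^sub>R unit_fseq (h d) = (if d = c then norm c *\<^sub>R unit_fseq (h c) else 0)"
      proof (cases "d = c")
        case True
        then show ?thesis
          by (simp add: power2_norm_eq_inner[symmetric] power2_eq_square)
      next
        case False
        then have "c \<bullet> d = 0"
          using C(3) that \<open>d \<in> C\<close> by (auto simp: pairwise_def orthogonal_def)
        with False show ?thesis by simp
      qed
    qed simp
    also have "\<dots> = norm c *\<^sub>R unit_fseq (h c)"
      using C(1) that by simp
    finally show ?thesis .
  qed
  have CC: "\<phi> c \<bullet> \<phi> d = c \<bullet> d" if "c \<in> C" "d \<in> C" for c d
  proof (cases "c = d")
    case True
    then show ?thesis
      using that by (simp add: \<phi>C norm_unit_fseq inner_unit_fseq power2_norm_eq_inner[symmetric] power2_eq_square)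
  next
    case False
    then have "c \<bullet> d = 0" "h c \<noteq> h d"
      using C(3) h that by (auto simp: pairwise_def orthogonal_def inj_on_def)
    then show ?thesis
      using that by (simp add: \<phi>C inner_unit_fseq)
  qed
  have HC: "\<phi> x \<bullet> \<phi> d = x \<bullet> d" if "x \<in> span C" "d \<in> C" for x d
    using that(1)
  proof (induction rule: span_induct_alt)
    case base
    then show ?case by (simp add: linear_0[OF lin])
  next
    case (step r c y)
    then show ?case
      using CC[of c d] that(2)
      by (simp add: linear_add[OF lin] linear_scale[OF lin] inner_add_left)
  qed
  have HH: "\<phi> x \<bullet> \<phi> y = x \<bullet> y" if "x \<in> span C" "y \<in> span C" for x y
    using that(2)
  proof (induction rule: span_induct_alt)
    case base
    then show ?case by (simp add: linear_0[OF lin])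
  next
    case (step r c y)
    then show ?case
      using HC[of x c] that(1)
      by (simp add: linear_add[OF lin] linear_scale[OF lin] inner_add_right)
  qed
  have "\<phi> ` H = span (\<phi> ` C)"
    by (simp add: C(2) linear_span_image[OF lin])
  then have "finite_dimensional (\<phi> ` H)"
    using C(1) by (auto simp: finite_dimensional_def)
  with lin HH C(2) that show thesis
    by blast
qed

lemma signed_hom_universal:
  fixes Hp :: "'a::real_inner set" and Hm :: "'b::real_inner set"
  assumes "finite_dimensional Hp" "finite_dimensional Hm"
    and "signed_hom \<tau> f \<Sigma> (signed_sphere t Hp Hm)"
  shows "\<exists>g (Ap :: fseq set) (Am :: fseq set).
    finite_dimensional Ap \<and> finite_dimensional Am \<and>
    signed_hom \<tau> g \<Sigma> (signed_sphere t Ap Am)"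
proof -
  obtain \<phi> :: "'a \<Rightarrow> fseq" where \<phi>: "finite_dimensional (\<phi> ` Hp)"
    "\<And>x y. x \<in> Hp \<Longrightarrow> y \<in> Hp \<Longrightarrow> \<phi> x \<bullet> \<phi> y = x \<bullet> y"
    using finite_dimensional_embed[OF assms(1)] by metis
  obtain \<psi> :: "'b \<Rightarrow> fseq" where \<psi>: "finite_dimensional (\<psi> ` Hm)"
    "\<And>x y. x \<in> Hm \<Longrightarrow> y \<in> Hm \<Longrightarrow> \<psi> x \<bullet> \<psi> y = x \<bullet> y"
    using finite_dimensional_embed[OF assms(2)] by metis
  let ?e = "map_prod \<phi> \<psi>"
  have "signed_hom \<tau> (?e \<circ> f) \<Sigma> (signed_sphere t (\<phi> ` Hp) (\<psi> ` Hm))"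
    using assms(3)
    by (fastforce simp: signed_hom_def signed_sphere_def Let_def image_subset_iff mem_Times_iff
        norm_eq_sqrt_inner inner_prod_def reflection_def \<phi>(2) \<psi>(2) split: sign.splits)
  with \<phi>(1) \<psi>(1) show ?thesis
    by blast
qed

definition balanced_theta :: "'v sgraph \<Rightarrow> real" where
  "balanced_theta \<Sigma> = Inf {t. 1 \<le> t \<and>
     (\<exists>(Hp :: fseq set) (Hm :: fseq set) \<tau> f.
        finite_dimensional Hp \<and> finite_dimensional Hm \<and>
        signed_hom \<tau> f (completion \<Sigma>) (signed_sphere t Hp Hm))}"


section \<open>Theta bodies\<close>

definition conflict_adj :: "'v sgraph \<Rightarrow> 'v \<times> sign \<Rightarrow> 'v \<times> sign \<Rightarrow> bool" where
  "conflict_adj \<Sigma> = (\<lambda>(u, s) (v, r). \<exists>e. edge (completion \<Sigma>) u v e \<and> r = - (e * s))"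

lemma conflict_adj_simple:
  assumes "signed_graph \<Sigma>"
  shows "symp (conflict_adj \<Sigma>)" "irreflp (conflict_adj \<Sigma>)"
proof -
  have *: "s = - (e * (- (e * s)))" for e s :: sign
    by (cases e; cases s) (simp_all add: times_sign_def uminus_sign_def)
  show "symp (conflict_adj \<Sigma>)"
    using assms * by (fastforce simp: symp_def conflict_adj_def signed_graph_def completion_def)
  have eM: "e = Minus" if "s = - (e * s)" for e s :: sign
    using that by (cases e; cases s) (simp_all add: times_sign_def uminus_sign_def)
  show "irreflp (conflict_adj \<Sigma>)"
    using assms by (auto dest!: eM simp: irreflp_def conflict_adj_def signed_graph_def completion_def)
qed

definition positive_semidefinite :: "real^'n^'n \<Rightarrow> bool" where
  "positive_semidefinite A \<longleftrightarrow> transpose A = A \<and> (\<forall>v. 0 \<le> v \<bullet> (A *v v))"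

text \<open>The matrix with corner entry \<open>1\<close>, border \<open>x\<close> and main block \<open>X\<close>; the additional index
  is \<open>None\<close>.\<close>

definition bordered :: "real^'n \<Rightarrow> real^'n^'n \<Rightarrow> real^('n option)^('n option)" where
  "bordered x X = (\<chi> i j. case (i, j) of
      (None, None) \<Rightarrow> 1
    | (None, Some v) \<Rightarrow> x $ v
    | (Some u, None) \<Rightarrow> x $ u
    | (Some u, Some v) \<Rightarrow> X $ u $ v)"

definition theta_body :: "('n::finite \<Rightarrow> 'n \<Rightarrow> bool) \<Rightarrow> (real^'n) set" where
  "theta_body adj = {x. \<exists>X :: real^'n^'n.
     transpose X = X \<and> positive_semidefinite (bordered x X) \<and>
     (\<forall>u. X $ u $ u = x $ u) \<and> (\<forall>u v. adj u v \<longrightarrow> X $ u $ v = 0)}"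

definition merge_signs :: "real^('v \<times> sign) \<Rightarrow> real^'v" where
  "merge_signs y = (\<chi> v. y $ (v, Plus) + y $ (v, Minus))"

text \<open>Vectors are indexed by the whole type, so this is meant for signed graphs whose vertex set
  is \<open>UNIV\<close>.\<close>

definition BTH :: "('v::finite) sgraph \<Rightarrow> (real^'v) set" where
  "BTH \<Sigma> = merge_signs ` theta_body (conflict_adj \<Sigma>)"

definition corner_gauge :: "'a::real_vector set \<Rightarrow> 'a \<Rightarrow> real" where
  "corner_gauge C z = Inf {l. 0 < l \<and> z \<in> (\<lambda>x. l *\<^sub>R x) ` C}"

end

theory Submission
  imports Defs
begin

text \<open>For each \<open>t\<close> a signed homomorphism into the sphere exists iff \<open>\<one> \<in> t \<cdot> BTH\<close>, so the two infima
  are taken over the same set. From a homomorphism \<open>(\<tau>, f)\<close>, the vectors \<open>f v\<close> and \<open>R (f v)\<close> are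
  attached to \<open>(v, \<plusminus>\<tau> v)\<close>; adjacent vertices of the conflict graph then have inner product
  \<open>- 1 / (2 t - 1)\<close>, so \<open>(1 + (2 t - 1) Gram) / (4 t\<^sup>2)\<close> witnesses that the constant vector \<open>1 / (2 t)\<close>
  lies in the theta body. Conversely, averaging a witness \<open>X\<close> over the automorphism
  \<open>(v, s) \<mapsto> (v, - s)\<close> splits it into an even and an odd part; Gram factorizations of these
  give the components in \<open>H\<^sub>+\<close> and \<open>H\<^sub>-\<close>.\<close>

section \<open>Finite sums over signs and options, and quadratic forms\<close>

lemma UNIV_sign: "UNIV = {Plus, Minus}"
  using sign.exhaust by auto

lemma sum_prod_sign:
  "(\<Sum>p\<in>UNIV. h p) = (\<Sum>v\<in>UNIV. h (v, Plus) + h (v, Minus))"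
  for h :: "'v::finite \<times> sign \<Rightarrow> 'b::comm_monoid_add"
  by (simp add: UNIV_Times_UNIV[symmetric] sum.cartesian_product' UNIV_sign del: UNIV_Times_UNIV)

lemma sum_UNIV_option:
  "(\<Sum>p\<in>UNIV. h p) = h None + (\<Sum>v\<in>UNIV. h (Some v))"
  for h :: "'v::finite option \<Rightarrow> 'b::comm_monoid_add"
  by (simp add: UNIV_option_conv sum.reindex)

lemma inner_matrix_vector_mult_eq_sum:
  "v \<bullet> (A *v v) = (\<Sum>i\<in>UNIV. \<Sum>j\<in>UNIV. v $ i * v $ j * A $ i $ j)" for A :: "real^'n^'n"
  by (simp add: inner_vec_def matrix_vector_mult_def sum_distrib_left mult_ac)


section \<open>Gram factorization\<close>

text \<open>Isolates the new index \<open>k\<close>: the form becomes a quadratic polynomial in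
  \<open>v k\<close>, and symmetry merges its two mixed sums.\<close>

lemma quadratic_form_insert:
  fixes M :: "'a \<Rightarrow> 'a \<Rightarrow> real"
  assumes "finite S" "k \<notin> S" "\<And>i j. M i j = M j i"
  shows "(\<Sum>i\<in>insert k S. \<Sum>j\<in>insert k S. v i * v j * M i j) =
    (\<Sum>i\<in>S. \<Sum>j\<in>S. v i * v j * M i j) + 2 * v k * (\<Sum>j\<in>S. v j * M k j) + (v k)\<^sup>2 * M k k"
proof -
  have "(\<Sum>i\<in>S. v i * v k * M i k) = v k * (\<Sum>j\<in>S. v j * M k j)"
    using assms(3) by (simp add: sum_distrib_left mult_ac)
  moreover have "(\<Sum>j\<in>S. v k * v j * M k j) = v k * (\<Sum>j\<in>S. v j * M k j)"
    by (simp add: sum_distrib_left mult_ac)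
  ultimately show ?thesis
    using assms(1,2) by (simp add: sum.distrib power2_eq_square)
qed

text \<open>Cholesky elimination of one index at a time. Division by a zero pivot yields \<open>0\<close>, which is the
  right value because the whole row of a zero pivot vanishes.\<close>

lemma gram_factorization:
  fixes M :: "'a \<Rightarrow> 'a \<Rightarrow> real"
  assumes "finite S" "\<And>i j. M i j = M j i"
    and "\<And>v. 0 \<le> (\<Sum>i\<in>S. \<Sum>j\<in>S. v i * v j * M i j)"
  shows "\<exists>G. \<forall>i\<in>S. \<forall>j\<in>S. M i j = (\<Sum>l\<in>S. G i l * G j l)"
  using assms
proof (induction S arbitrary: M rule: finite_induct)
  case empty
  then show ?case by simp
next
  case (insert k S)
  note quad = quadratic_form_insert[OF insert.hyps(1,2), of M, OF insert.prems(1)]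
  define m where "m = M k k"
  have pos: "0 \<le> (\<Sum>i\<in>S. \<Sum>j\<in>S. v i * v j * M i j) + 2 * c * (\<Sum>j\<in>S. v j * M k j) + c\<^sup>2 * m"
    for v c
  proof -
    have *: "(\<Sum>i\<in>S. \<Sum>j\<in>S. (v(k := c)) i * (v(k := c)) j * M i j) = (\<Sum>i\<in>S. \<Sum>j\<in>S. v i * v j * M i j)"
      "(\<Sum>j\<in>S. (v(k := c)) j * M k j) = (\<Sum>j\<in>S. v j * M k j)"
      using insert.hyps by (auto intro!: sum.cong)
    show ?thesis
      using insert.prems(2)[of "v(k := c)"] unfolding quad * by (simp add: m_def)
  qed
  have m: "0 \<le> m"
    using pos[of "\<lambda>_. 0" 1] by simp
  have zero_row: "M k j = 0" if "m = 0" "j \<in> S" for j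
  proof (rule ccontr)
    assume nz: "M k j \<noteq> 0"
    have 1: "(\<Sum>i\<in>S. (if i = j then 1 else 0) * M k i) = M k j"
      using insert.hyps that by (simp add: if_distrib if_distribR cong: if_cong)
    define q where "q = (\<Sum>i\<in>S. \<Sum>l\<in>S. (if i = j then 1 else 0) * (if l = j then 1 else 0) * M i l)"
    \<comment> \<open>With a zero pivot the form is affine in \<open>c\<close> with slope
      \<open>2 * M k j\<close>; this choice of \<open>c\<close> brings it down to -1.\<close>
    have "0 \<le> q + 2 * (- (q + 1) / (2 * M k j)) * M k j"
      using pos[of "\<lambda>i. if i = j then 1 else 0" "- (q + 1) / (2 * M k j)"] that
      unfolding 1 by (simp add: q_def)
    with nz show False by (simp add: field_simps)
  qed
  \<comment> \<open>The Schur complement of the pivot; for \<open>m = 0\<close> it is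
    \<open>M\<close> itself.\<close>
  define M' where "M' i j = M i j - M k i * M k j / m" for i j
  have "0 \<le> (\<Sum>i\<in>S. \<Sum>j\<in>S. v i * v j * M' i j)" for v
  proof -
    define c where "c = (\<Sum>j\<in>S. v j * M k j)"
    have "(\<Sum>i\<in>S. \<Sum>j\<in>S. v i * v j * M' i j)
        = (\<Sum>i\<in>S. \<Sum>j\<in>S. v i * v j * M i j) - (\<Sum>i\<in>S. \<Sum>j\<in>S. v i * M k i * (v j * M k j)) / m"
      by (simp add: M'_def sum_subtractf[symmetric] sum_divide_distrib algebra_simps)
    also have "(\<Sum>i\<in>S. \<Sum>j\<in>S. v i * M k i * (v j * M k j)) = c\<^sup>2"
      by (simp add: c_def power2_eq_square sum_product)
    finally show ?thesis
      \<comment> \<open>For \<open>m > 0\<close> the value \<open>- c / m\<close> minimizes the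
        quadratic polynomial of \<open>pos\<close>; the minimum is the form of
        \<open>M'\<close>.\<close>
      using pos[of v "- c / m"] by (cases "m = 0") (simp_all add: c_def[symmetric] power2_eq_square)
  qed
  moreover have "M' i j = M' j i" for i j
    by (simp add: M'_def insert.prems(1)[of i j])
  ultimately obtain G where G: "M' i j = (\<Sum>l\<in>S. G i l * G j l)" if "i \<in> S" "j \<in> S" for i j
    using insert.IH[of M'] by blast
  \<comment> \<open>Column \<open>k\<close> carries the pivot row divided by \<open>sqrt m\<close>,
    which restores what \<open>M'\<close> subtracts.\<close>
  define G' where "G' i l = (if l = k then M k i / sqrt m else if i = k then 0 else G i l)" for i l
  have S: "(\<Sum>l\<in>S. G' i l * G' j l) = (if i = k \<or> j = k then 0 else M' i j)"
    if "i \<in> insert k S" "j \<in> insert k S" for i j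
    using that insert.hyps G[of i j] by (auto simp: G'_def intro!: sum.neutral sum.cong)
  have Gk: "G' i k * G' j k = M k i * M k j / m" for i j
    using m by (simp add: G'_def)
  have "(\<Sum>l\<in>insert k S. G' i l * G' j l) = M i j"
    if "i \<in> insert k S" "j \<in> insert k S" for i j
    using that insert.hyps zero_row[of i] zero_row[of j] insert.prems(1)[of i k] insert.prems(1)[of j k]
    by (cases "m = 0") (auto simp: S Gk M'_def m_def simp del: mult_eq_0_iff)
  then show ?case by (intro exI[of _ G']) auto
qed

lemma gram_vectors:
  fixes M :: "'v::finite \<Rightarrow> 'v \<Rightarrow> real"
  assumes "\<And>i j. M i j = M j i"
    and "\<And>v. 0 \<le> (\<Sum>i\<in>UNIV. \<Sum>j\<in>UNIV. v i * v j * M i j)"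
  obtains g :: "'v \<Rightarrow> real^'v" where "\<And>i j. g i \<bullet> g j = M i j"
proof -
  obtain G :: "'v \<Rightarrow> 'v \<Rightarrow> real" where "\<forall>i\<in>UNIV. \<forall>j\<in>UNIV. M i j = (\<Sum>l\<in>UNIV. G i l * G j l)"
    using gram_factorization[OF finite_class.finite_UNIV assms] by blast
  then show thesis
    by (intro that[of "\<lambda>i. \<chi> l. G i l"]) (simp add: inner_vec_def)
qed


section \<open>Theta bodies by Schur complement\<close>

text \<open>Complete the square in the border coordinate. The corner entry is 1, so the minimum over
  that coordinate is \<open>v \<bullet> (X *v v) - (x \<bullet> v)\<^sup>2\<close>.\<close>

lemma positive_semidefinite_bordered_iff:
  fixes X :: "real^'n^'n"
  assumes "transpose X = X"
  shows "positive_semidefinite (bordered x X) \<longleftrightarrow> (\<forall>v. (x \<bullet> v)\<^sup>2 \<le> v \<bullet> (X *v v))"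
proof -
  have sym: "transpose (bordered x X) = bordered x X"
  proof -
    have "X $ i $ j = X $ j $ i" for i j
      using assms by (metis transpose_def vec_lambda_beta)
    then show ?thesis
      by (auto simp: vec_eq_iff transpose_def bordered_def split: option.splits)
  qed
  have quad: "w \<bullet> (bordered x X *v w) = (w $ None)\<^sup>2 + 2 * w $ None * (x \<bullet> v) + v \<bullet> (X *v v)"
    if "v = (\<chi> i. w $ Some i)" for w v
    unfolding that inner_matrix_vector_mult_eq_sum
    by (simp add: sum_UNIV_option bordered_def inner_vec_def sum.distrib sum_distrib_left
        power2_eq_square algebra_simps)
  show ?thesis
  proof (intro iffI allI)
    fix v assume "positive_semidefinite (bordered x X)"
    \<comment> \<open>The border entry is the minimizer of the form for fixed
      \<open>v\<close>.\<close>
    moreover define w where "w = (\<chi> i. case i of None \<Rightarrow> - (x \<bullet> v) | Some j \<Rightarrow> v $ j)"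
    ultimately have "0 \<le> w \<bullet> (bordered x X *v w)"
      by (simp add: positive_semidefinite_def)
    also have "\<dots> = v \<bullet> (X *v v) - (x \<bullet> v)\<^sup>2"
      by (subst quad[of v]) (simp_all add: w_def power2_eq_square vec_eq_iff)
    finally show "(x \<bullet> v)\<^sup>2 \<le> v \<bullet> (X *v v)" by simp
  next
    assume *: "\<forall>v. (x \<bullet> v)\<^sup>2 \<le> v \<bullet> (X *v v)"
    have "0 \<le> w \<bullet> (bordered x X *v w)" for w
    proof -
      define v where "v = (\<chi> i. w $ Some i)"
      have "0 \<le> (w $ None + x \<bullet> v)\<^sup>2" by simp
      also have "\<dots> \<le> w \<bullet> (bordered x X *v w)"
        using * by (simp add: quad[OF v_def] power2_sum)
      finally show ?thesis .
    qed
    with sym show "positive_semidefinite (bordered x X)"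
      by (simp add: positive_semidefinite_def)
  qed
qed

lemma theta_body_iff:
  "x \<in> theta_body adj \<longleftrightarrow> (\<exists>X. transpose X = X \<and> (\<forall>v. (x \<bullet> v)\<^sup>2 \<le> v \<bullet> (X *v v)) \<and>
     (\<forall>u. X $ u $ u = x $ u) \<and> (\<forall>u v. adj u v \<longrightarrow> X $ u $ v = 0))"
  unfolding theta_body_def using positive_semidefinite_bordered_iff by blast

lemma constant_in_theta_body:
  fixes z :: "'n::finite \<Rightarrow> 'a::real_inner"
  assumes "1 \<le> t" "\<And>i. norm (z i) = 1" "\<And>i j. adj i j \<Longrightarrow> z i \<bullet> z j = gamma_t t"
  shows "(\<chi> i. 1 / (2 * t)) \<in> theta_body adj"
proof -
  \<comment> \<open>The all-ones part of \<open>X\<close> contributes exactly the square of the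
    linear form. The factor \<open>2 * t - 1\<close> makes an entry vanish where the inner product
    is \<open>gamma_t t\<close>, and \<open>4 * t\<^sup>2\<close> makes the diagonal equal to
    \<open>1 / (2 * t)\<close>.\<close>
  define X :: "real^'n^'n" where "X = (\<chi> i j. (1 + (2 * t - 1) * (z i \<bullet> z j)) / (4 * t\<^sup>2))"
  have "transpose X = X"
    by (simp add: X_def transpose_def inner_commute)
  moreover have "((\<chi> i. 1 / (2 * t)) \<bullet> v)\<^sup>2 \<le> v \<bullet> (X *v v)" for v
  proof -
    define w where "w = (\<Sum>i\<in>UNIV. v $ i *\<^sub>R z i)"
    have "v \<bullet> (X *v v) = ((\<Sum>i\<in>UNIV. \<Sum>j\<in>UNIV. v $ i * v $ j)
        + (2 * t - 1) * (\<Sum>i\<in>UNIV. \<Sum>j\<in>UNIV. v $ i * v $ j * (z i \<bullet> z j))) / (4 * t\<^sup>2)"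
      by (simp add: inner_matrix_vector_mult_eq_sum X_def sum_distrib_left sum.distrib[symmetric]
          sum_divide_distrib algebra_simps)
    also have "(\<Sum>i\<in>UNIV. \<Sum>j\<in>UNIV. v $ i * v $ j * (z i \<bullet> z j)) = w \<bullet> w"
      by (simp add: w_def inner_sum_left inner_sum_right sum_distrib_left inner_commute mult_ac)
    also have "(\<Sum>i\<in>UNIV. \<Sum>j\<in>UNIV. v $ i * v $ j) = (\<Sum>i\<in>UNIV. v $ i)\<^sup>2"
      by (simp add: power2_eq_square sum_product)
    finally have "v \<bullet> (X *v v) = ((\<Sum>i\<in>UNIV. v $ i)\<^sup>2 + (2 * t - 1) * (w \<bullet> w)) / (4 * t\<^sup>2)" .
    moreover have "((\<chi> i. 1 / (2 * t)) \<bullet> v)\<^sup>2 = (\<Sum>i\<in>UNIV. v $ i)\<^sup>2 / (4 * t\<^sup>2)"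
      by (simp add: inner_vec_def sum_divide_distrib[symmetric] power_divide power_mult_distrib)
    ultimately show ?thesis
      using assms(1) by (simp add: divide_right_mono)
  qed
  moreover have "z i \<bullet> z i = 1" for i
    using assms(2)[of i] by (simp add: norm_eq_sqrt_inner)
  then have "X $ i $ i = 1 / (2 * t)" for i
    using assms(1) by (simp add: X_def power2_eq_square)
  moreover have "X $ i $ j = 0" if "adj i j" for i j
    using assms(1) assms(3)[OF that] by (simp add: X_def gamma_t_def field_simps)
  ultimately show ?thesis
    unfolding theta_body_iff by (intro exI[of _ X]) auto
qed


section \<open>Signed homomorphisms into signed spheres\<close>

lemma inner_reflection_left: "reflection x \<bullet> y = x \<bullet> reflection y"
  by (simp add: reflection_def inner_prod_def)

lemma reflection_reflection [simp]: "reflection (reflection x) = x"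
  by (simp add: reflection_def)

lemma norm_reflection [simp]: "norm (reflection x) = norm x"
  by (simp add: norm_eq_sqrt_inner inner_reflection_left)

lemma constant_in_BTH_if_signed_hom:
  fixes \<Sigma> :: "('v::finite) sgraph" and Hp :: "'a::real_inner set" and Hm :: "'b::real_inner set"
  assumes "verts \<Sigma> = UNIV" "1 \<le> t" "signed_hom \<tau> f (completion \<Sigma>) (signed_sphere t Hp Hm)"
  shows "(\<chi> v. 1 / t) \<in> BTH \<Sigma>"
proof -
  have f: "norm (f v) = 1" for v
    using assms(1,3) by (auto simp: signed_hom_def signed_sphere_def Let_def completion_def)
  have edge: "(case \<tau> u * e * \<tau> v of Plus \<Rightarrow> f u \<bullet> reflection (f v) = gamma_t t
      | Minus \<Rightarrow> f u \<bullet> f v = gamma_t t)" if "edge (completion \<Sigma>) u v e" for u v e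
    using assms(3) that by (simp add: signed_hom_def signed_sphere_def Let_def)
  define z where "z p = (if \<tau> (fst p) = snd p then f (fst p) else reflection (f (fst p)))" for p
  have "z p \<bullet> z q = gamma_t t" if adj: "conflict_adj \<Sigma> p q" for p q
  proof -
    obtain u s v e where *: "p = (u, s)" "q = (v, - (e * s))" "edge (completion \<Sigma>) u v e"
      using adj by (auto simp: conflict_adj_def split: prod.splits)
    \<comment> \<open>If \<open>\<tau> u * e * \<tau> v\<close> is \<open>Minus\<close>, both or
      neither of the vectors are reflected; if it is \<open>Plus\<close>, exactly one is. As the
      reflection is a self-adjoint involution, this yields the inner product that the sphere
      prescribes for that sign.\<close>
    show ?thesis
      using edge[OF *(3)] *(1,2)
      by (cases "\<tau> u"; cases "\<tau> v"; cases e; cases s)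
        (simp_all add: z_def times_sign_def uminus_sign_def inner_reflection_left)
  qed
  then have "(\<chi> p. 1 / (2 * t)) \<in> theta_body (conflict_adj \<Sigma>)"
    by (intro constant_in_theta_body[where z = z] assms(2)) (auto simp: z_def f)
  then have "merge_signs (\<chi> p. 1 / (2 * t)) \<in> BTH \<Sigma>"
    unfolding BTH_def by (rule imageI)
  also have "merge_signs (\<chi> p. 1 / (2 * t)) = (\<chi> v::'v. 1 / t)"
    by (simp add: merge_signs_def vec_eq_iff)
  finally show ?thesis .
qed

text \<open>Testing a theta body witness on sign-even and sign-odd vectors gives two positive
  semidefinite matrices on the vertices. Their suitably shifted and scaled Gram vectors are the two
  components of the map.\<close>

lemma signed_hom_if_constant_in_BTH:
  fixes \<Sigma> :: "('v::finite) sgraph"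
  assumes "verts \<Sigma> = UNIV" "0 < t" "(\<chi> v. 1 / t) \<in> BTH \<Sigma>"
  shows "1 \<le> t" "\<exists>f. signed_hom (\<lambda>_. Plus) f (completion \<Sigma>)
    (signed_sphere t (UNIV :: (real^'v) set) (UNIV :: (real^'v) set))"
proof -
  obtain y where y: "y \<in> theta_body (conflict_adj \<Sigma>)" and "merge_signs y = (\<chi> v. 1 / t)"
    using assms(3) by (auto simp: BTH_def)
  then have y_sum: "y $ (v, Plus) + y $ (v, Minus) = 1 / t" for v
    by (simp add: merge_signs_def vec_eq_iff)
  obtain X where "transpose X = X"
    and X: "\<And>v. (y \<bullet> v)\<^sup>2 \<le> v \<bullet> (X *v v)" "\<And>p. X $ p $ p = y $ p"
    and adj: "\<And>p q. conflict_adj \<Sigma> p q \<Longrightarrow> X $ p $ q = 0"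
    using y unfolding theta_body_iff by blast
  have sym: "X $ p $ q = X $ q $ p" for p q
    using arg_cong[OF \<open>transpose X = X\<close>, of "\<lambda>A. A $ q $ p"] by (simp add: transpose_def)
  have edge: "X $ (u, s) $ (v, - (e * s)) = 0" if "edge (completion \<Sigma>) u v e" for u v e s
    using that by (intro adj) (auto simp: conflict_adj_def)
  have plus: "X $ (u, Plus) $ (v, Minus) = 0" "X $ (u, Minus) $ (v, Plus) = 0"
    if "edge (completion \<Sigma>) u v Plus" for u v
    using edge[OF that, of Plus] edge[OF that, of Minus]
    by (simp_all add: times_sign_def uminus_sign_def)
  have minus: "X $ (u, Plus) $ (v, Plus) = 0" "X $ (u, Minus) $ (v, Minus) = 0"
    if "edge (completion \<Sigma>) u v Minus" for u v
    using edge[OF that, of Plus] edge[OF that, of Minus]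
    by (simp_all add: times_sign_def uminus_sign_def)
  have loop: "edge (completion \<Sigma>) v v Plus" for v
    using assms(1) by (simp add: completion_def)
  \<comment> \<open>Up to a factor, \<open>P\<close> and \<open>N\<close> are the blocks of
    \<open>X\<close> on sign-even and sign-odd vectors. The loops kill the mixed terms on their
    diagonals.\<close>
  define P where "P u v = X $ (u, Plus) $ (v, Plus) + X $ (u, Plus) $ (v, Minus)
    + X $ (u, Minus) $ (v, Plus) + X $ (u, Minus) $ (v, Minus)" for u v
  define N where "N u v = X $ (u, Plus) $ (v, Plus) - X $ (u, Plus) $ (v, Minus)
    - X $ (u, Minus) $ (v, Plus) + X $ (u, Minus) $ (v, Minus)" for u v
  have diag: "P v v = 1 / t" "N v v = 1 / t" for v
    using plus[OF loop] y_sum by (simp_all add: P_def N_def X)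
  have Ppos: "((\<Sum>v\<in>UNIV. w v) / t)\<^sup>2 \<le> (\<Sum>u\<in>UNIV. \<Sum>v\<in>UNIV. w u * w v * P u v)" for w
  proof -
    define x :: "real^('v \<times> sign)" where "x = (\<chi> p. w (fst p))"
    have "y \<bullet> x = (\<Sum>v\<in>UNIV. (y $ (v, Plus) + y $ (v, Minus)) * w v)"
      by (simp add: inner_vec_def sum_prod_sign x_def algebra_simps)
    then have "y \<bullet> x = (\<Sum>v\<in>UNIV. w v) / t"
      unfolding y_sum by (simp add: sum_divide_distrib)
    moreover have "x \<bullet> (X *v x) = (\<Sum>u\<in>UNIV. \<Sum>v\<in>UNIV. w u * w v * P u v)"
      by (simp add: inner_matrix_vector_mult_eq_sum sum_prod_sign x_def P_def
          sum.distrib[symmetric] algebra_simps)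
    ultimately show ?thesis
      using X(1)[of x] by simp
  qed
  have Npos: "0 \<le> (\<Sum>u\<in>UNIV. \<Sum>v\<in>UNIV. w u * w v * N u v)" for w
  proof -
    define x where "x = (\<chi> p. if snd p = Plus then w (fst p) else - w (fst p))"
    have "x \<bullet> (X *v x) = (\<Sum>u\<in>UNIV. \<Sum>v\<in>UNIV. w u * w v * N u v)"
      by (simp add: inner_matrix_vector_mult_eq_sum sum_prod_sign x_def N_def
          sum.distrib[symmetric] algebra_simps)
    then show ?thesis
      using X(1)[of x] zero_le_power2[of "y \<bullet> x"] by linarith
  qed
  show t: "1 \<le> t"
  proof -
    \<comment> \<open>The indicator of a single vertex turns \<open>Ppos\<close> into
      \<open>(1 / t)\<^sup>2 \<le> 1 / t\<close>.\<close>
    fix v :: 'v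
    have "(if i = v then 1 else 0) * (if j = v then 1 else 0) * P i j =
        (if j = v then if i = v then P v v else 0 else 0)" for i j
      by simp
    then have "(1 / t)\<^sup>2 \<le> 1 / t"
      using Ppos[of "\<lambda>u. if u = v then 1 else 0"] by (simp add: diag)
    then show ?thesis
      using assms(2) by (simp add: power2_eq_square field_simps)
  qed
  \<comment> \<open>The shift by 1 uses up the linear term in \<open>Ppos\<close>. With this scaling
    the squared norms of the components are \<open>(t - 1) / (2 * t - 1)\<close> and
    \<open>t / (2 * t - 1)\<close>: their sum is 1 and their difference is
    \<open>gamma_t t\<close>.\<close>
  have "0 \<le> (\<Sum>u\<in>UNIV. \<Sum>v\<in>UNIV. w u * w v * ((t\<^sup>2 * P u v - 1) / (2 * t - 1)))" for w
  proof -
    have "(\<Sum>u\<in>UNIV. \<Sum>v\<in>UNIV. w u * w v * ((t\<^sup>2 * P u v - 1) / (2 * t - 1)))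
        = (t\<^sup>2 * (\<Sum>u\<in>UNIV. \<Sum>v\<in>UNIV. w u * w v * P u v) - (\<Sum>u\<in>UNIV. w u)\<^sup>2) / (2 * t - 1)"
      unfolding power2_eq_square[of "sum w UNIV"] sum_product
      by (simp add: sum_distrib_left sum_subtractf[symmetric] sum_divide_distrib algebra_simps)
    moreover have "(\<Sum>u\<in>UNIV. w u)\<^sup>2 \<le> t\<^sup>2 * (\<Sum>u\<in>UNIV. \<Sum>v\<in>UNIV. w u * w v * P u v)"
      using Ppos[of w] t by (simp add: field_simps)
    ultimately show ?thesis
      using t by simp
  qed
  moreover have "P u v = P v u" for u v
    using sym by (simp add: P_def)
  ultimately obtain a :: "'v \<Rightarrow> real^'v" where a: "a u \<bullet> a v = (t\<^sup>2 * P u v - 1) / (2 * t - 1)" for u v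
    using gram_vectors[of "\<lambda>u v. (t\<^sup>2 * P u v - 1) / (2 * t - 1)"] by metis
  have "0 \<le> (\<Sum>u\<in>UNIV. \<Sum>v\<in>UNIV. w u * w v * (t\<^sup>2 * N u v / (2 * t - 1)))" for w
  proof -
    have "(\<Sum>u\<in>UNIV. \<Sum>v\<in>UNIV. w u * w v * (t\<^sup>2 * N u v / (2 * t - 1)))
        = t\<^sup>2 / (2 * t - 1) * (\<Sum>u\<in>UNIV. \<Sum>v\<in>UNIV. w u * w v * N u v)"
      by (simp add: sum_distrib_left sum_divide_distrib algebra_simps)
    then show ?thesis
      using t Npos[of w] by simp
  qed
  moreover have "N u v = N v u" for u v
    using sym by (simp add: N_def)
  ultimately obtain b :: "'v \<Rightarrow> real^'v" where b: "b u \<bullet> b v = t\<^sup>2 * N u v / (2 * t - 1)" for u v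
    using gram_vectors[of "\<lambda>u v. t\<^sup>2 * N u v / (2 * t - 1)"] by metis
  define f where "f v = (a v, b v)" for v
  \<comment> \<open>\<open>P + N\<close> keeps only equal-sign entries of \<open>X\<close> and
    \<open>P - N\<close> only mixed ones, so they vanish on negative and positive edges
    respectively.\<close>
  have inner: "f u \<bullet> f v = (t\<^sup>2 * (P u v + N u v) - 1) / (2 * t - 1)"
    and inner_refl: "f u \<bullet> reflection (f v) = (t\<^sup>2 * (P u v - N u v) - 1) / (2 * t - 1)" for u v
    by (simp_all add: f_def inner_prod_def reflection_def a b add_divide_distrib[symmetric]
        diff_divide_distrib[symmetric] algebra_simps)
  have gamma: "gamma_t t = - 1 / (2 * t - 1)"
    using t by (simp add: gamma_t_def field_simps)
  have norm: "norm (f v) = 1" for v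
    using t by (simp add: norm_eq_sqrt_inner inner diag power2_eq_square)
  have refl: "f v \<bullet> reflection (f v) = gamma_t t" for v
    by (simp add: inner_refl diag gamma)
  have "f u \<bullet> reflection (f v) = gamma_t t" if "edge (completion \<Sigma>) u v Plus" for u v
    using plus[OF that] by (simp add: inner_refl gamma P_def N_def)
  moreover have "f u \<bullet> f v = gamma_t t" if "edge (completion \<Sigma>) u v Minus" for u v
    using minus[OF that] by (simp add: inner gamma P_def N_def)
  ultimately have "case s of Plus \<Rightarrow> f u \<bullet> reflection (f v) = gamma_t t
      | Minus \<Rightarrow> f u \<bullet> f v = gamma_t t" if "edge (completion \<Sigma>) u v s" for u v s
    using that by (cases s) simp_all
  moreover have "Plus * s * Plus = s" for s
    by (cases s) (simp_all add: times_sign_def)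
  ultimately have "signed_hom (\<lambda>_. Plus) f (completion \<Sigma>)
      (signed_sphere t (UNIV :: (real^'v) set) (UNIV :: (real^'v) set))"
    by (simp add: signed_hom_def signed_sphere_def Let_def norm refl image_subset_iff)
  then show "\<exists>f. signed_hom (\<lambda>_. Plus) f (completion \<Sigma>)
      (signed_sphere t (UNIV :: (real^'v) set) (UNIV :: (real^'v) set))"
    by blast
qed

section \<open>Comparison of the two infima\<close>

theorem proposition7p4:
  fixes \<Sigma> :: "('v::finite) sgraph"
  assumes "signed_graph \<Sigma>" and "verts \<Sigma> = UNIV"
  shows "balanced_theta \<Sigma> = corner_gauge (BTH \<Sigma>) (\<chi> v. 1)"
proof -
  have scale: "(\<chi> v. 1) \<in> (\<lambda>x. t *\<^sub>R x) ` BTH \<Sigma> \<longleftrightarrow> (\<chi> v. 1 / t) \<in> BTH \<Sigma>" if "0 < t" for t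
  proof -
    have eq: "(\<chi> v. 1) = t *\<^sub>R x \<longleftrightarrow> x = (\<chi> v. 1 / t)" for x :: "real^'v"
      using that by (auto simp: vec_eq_iff field_simps)
    show ?thesis
      unfolding image_iff eq by simp
  qed
  have fd: "finite_dimensional (UNIV :: (real^'v) set)"
    using span_Basis finite_Basis unfolding finite_dimensional_def by metis
  \<comment> \<open>The ranges \<open>1 \<le> t\<close> and \<open>0 < t\<close> agree because
    membership in the body already forces \<open>1 \<le> t\<close>.\<close>
  have "1 \<le> t \<and> (\<exists>(Hp :: fseq set) (Hm :: fseq set) \<tau> f.
        finite_dimensional Hp \<and> finite_dimensional Hm \<and>
        signed_hom \<tau> f (completion \<Sigma>) (signed_sphere t Hp Hm))
      \<longleftrightarrow> 0 < t \<and> (\<chi> v. 1 / t) \<in> BTH \<Sigma>" (is "?hom \<longleftrightarrow> ?body") for t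
  proof
    assume ?hom
    then show ?body
      using constant_in_BTH_if_signed_hom[OF assms(2)] by fastforce
  next
    assume ?body
    \<comment> \<open>The map built from Gram vectors lands in a sphere over \<open>real^'v\<close>,
      which is then transported into \<open>fseq\<close>.\<close>
    with signed_hom_if_constant_in_BTH[OF assms(2)] signed_hom_universal[OF fd fd]
    show ?hom by meson
  qed
  then show ?thesis
    unfolding balanced_theta_def corner_gauge_def
    by (intro arg_cong[where f = Inf] Collect_cong) (simp add: scale cong: conj_cong)
qed

end
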